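(* For every integer $k$ with $1\le k\le p_n$ there exists a matrix $M_k$ on the boundary of $\mathcal{C}_n^*$ such that $\mathrm{cpr}\,M_k=k$.
   Context: Here $n$ is the order of the matrices considered. An $n\times n$ matrix $M$ is completely positive if $M=VV^\top$ for some entrywise nonnegative, not necessarily square, matrix $V$. $\mathcal{C}_n^*$ denotes the cone of completely positive $n\times n$ matrices; its boundary is taken in the space $\mathcal{S}_n$ of real symmetric $n\times n$ matrices. The cp-rank $\mathrm{cpr}\,M$ of a nonzero completely positive matrix $M$ is the minimum number of columns of an entrywise nonnegative $V$ with $M=VV^\top$; $\mathrm{cpr}\,M=0$ if $M$ is a square zero matrix, and $\mathrm{cpr}\,M=\infty$ if $M$ is not completely positive. $p_n=\max\{\mathrm{cpr}\,M : M \text{ is a completely positive } n\times n \text{ matrix}\}$.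
   Formalization: The order n is assumed to be at least 2; for n = 1 the claim fails, since the boundary of the cone is {0}, whose cp-rank is 0, while p_1 = 1, so k = 1 has no matrix. *)

theory Defs
  imports "HOL-Analysis.Analysis" "HOL-Library.Extended_Nat"
begin

(* "M = V V^T for an entrywise nonnegative n x m matrix V". As m varies, V is given by its
   entries V i l with row index i and column index l < m; values at l >= m are irrelevant. *)
definition cp_factorization :: "real^'n^'n \<Rightarrow> nat \<Rightarrow> ('n \<Rightarrow> nat \<Rightarrow> real) \<Rightarrow> bool" where
  "cp_factorization M m V \<longleftrightarrow>
     (\<forall>i. \<forall>l<m. 0 \<le> V i l) \<and> M = (\<chi> i j. \<Sum>l<m. V i l * V j l)"

definition completely_positive :: "real^'n^'n \<Rightarrow> bool" where
  "completely_positive M \<longleftrightarrow> (\<exists>m V. cp_factorization M m V)"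

definition cp_cone :: "(real^'n^'n) set" where
  "cp_cone = {M. completely_positive M}"

definition symmetric_matrices :: "(real^'n^'n) set" where
  "symmetric_matrices = {M. transpose M = M}"

(* The boundary is taken in the space of symmetric matrices: for n >= 2 the cone has empty
   interior in the space of all n x n matrices. *)
definition cp_boundary :: "(real^'n^'n) set" where
  "cp_boundary = top_of_set symmetric_matrices frontier_of cp_cone"

definition cp_rank :: "real^'n^'n \<Rightarrow> enat" where
  "cp_rank M =
     (if M = 0 then 0
      else if completely_positive M then enat (LEAST m. \<exists>V. cp_factorization M m V)
      else \<infinity>)"

(* The maximum exists: by Caratheodory's theorem every value is at most n (n + 1) / 2. *)
definition max_cp_rank :: "'n::finite itself \<Rightarrow> enat" where
  "max_cp_rank _ = Max (cp_rank ` (cp_cone :: (real^'n^'n) set))"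

end

theory Submission
  imports Defs
begin

text \<open>
  Let \<open>K\<^sub>m\<close> be the set of matrices of cp-rank at most \<open>m\<close>. It is invariant under
  \<open>N \<mapsto> A N A\<^sup>T\<close> for entrywise nonnegative \<open>A\<close>. Deforming the identity matrix linearly into the
  all-ones matrix therefore contracts \<open>K\<^sub>m\<close>, inside \<open>K\<^sub>m\<close>, to the ray through the all-ones
  matrix. If \<open>K\<^sub>m\<close> contained the boundary of the cone but missed an interior point \<open>P\<close>, the boundary,
  which is a sphere up to scaling, would be contractible in the complement of the ray through \<open>P\<close>,
  contradicting Brouwer's theorem. Hence the maximal cp-rank \<open>p\<close> is attained on the boundary
  (take \<open>m = p - 1\<close>; for \<open>n \<ge> 2\<close> this is positive). The sum of the first \<open>k\<close>
  rank-one terms of a minimal factorization of a boundary matrix has cp-rank \<open>k\<close> and is again on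
  the boundary.
\<close>

section \<open>A Brouwer argument for pointed cones\<close>

text \<open>Since \<open>C\<close> is its own closure in \<open>E\<close>, only the interior has to
  be put into metric form.\<close>

lemma frontier_of_closed_iff:
  fixes C E :: "'a::metric_space set"
  assumes "closed C" "C \<subseteq> E"
  shows "x \<in> top_of_set E frontier_of C \<longleftrightarrow>
    x \<in> C \<and> \<not> (\<exists>e>0. \<forall>y\<in>E. dist y x < e \<longrightarrow> y \<in> C)"
proof -
  have "closedin (top_of_set E) C"
    using assms by (intro closed_subset)
  then have cl: "top_of_set E closure_of C = C"
    by (simp only: closure_of_eq)
  have "x \<in> top_of_set E interior_of C \<longleftrightarrow> (\<exists>e>0. \<forall>y\<in>E. dist y x < e \<longrightarrow> y \<in> C)" if "x \<in> C"
  proof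
    assume "x \<in> top_of_set E interior_of C"
    then show "\<exists>e>0. \<forall>y\<in>E. dist y x < e \<longrightarrow> y \<in> C"
      unfolding interior_of_def openin_euclidean_subtopology_iff by blast
  next
    assume "\<exists>e>0. \<forall>y\<in>E. dist y x < e \<longrightarrow> y \<in> C"
    then obtain e where e: "e > 0" "\<forall>y\<in>E. dist y x < e \<longrightarrow> y \<in> C" by blast
    then have "E \<inter> ball x e \<subseteq> C" "x \<in> E \<inter> ball x e" "openin (top_of_set E) (E \<inter> ball x e)"
      using that assms(2) by (auto simp: dist_commute)
    then show "x \<in> top_of_set E interior_of C"
      unfolding interior_of_def by blast
  qed
  then show ?thesis
    unfolding frontier_of_def cl by blast
qed

text \<open>A point \<open>P\<close> of \<open>C\<close> outside \<open>K\<close> is interior to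
  \<open>C\<close> relative to \<open>E\<close>. The frontier then projects along \<open>P\<close>
  onto the hyperplane \<open>H\<close> orthogonal to \<open>P\<close>, and nonzero points of
  \<open>K\<close> never project to 0. So \<open>h\<close>, carried over to \<open>H\<close>, would
  deform the unit sphere of \<open>H\<close> to a point while avoiding 0.\<close>

lemma pointed_cone_subset_if_frontier_contracts:
  fixes C K E :: "'a::euclidean_space set" and h :: "real \<Rightarrow> 'a \<Rightarrow> 'a"
  assumes E: "subspace E" and CE: "C \<subseteq> E" and C: "convex_cone C" "closed C"
    and pointed: "\<And>X. X \<in> C \<Longrightarrow> - X \<in> C \<Longrightarrow> X = 0"
    and bd: "top_of_set E frontier_of C \<subseteq> K" and KC: "K \<subseteq> C"
    and K: "\<And>N c. N \<in> K \<Longrightarrow> c > 0 \<Longrightarrow> c *\<^sub>R N \<in> K"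
    and J: "J \<in> K" "J \<noteq> 0"
    and h: "continuous_on UNIV (\<lambda>(t, N). h t N)"
    and hK: "\<And>t N. 0 \<le> t \<Longrightarrow> t \<le> 1 \<Longrightarrow> N \<in> K \<Longrightarrow> N \<noteq> 0 \<Longrightarrow> h t N \<in> K - {0}"
    and h0: "\<And>N. h 0 N = N"
    and h1: "\<And>N. N \<in> K \<Longrightarrow> N \<noteq> 0 \<Longrightarrow> \<exists>s>0. h 1 N = s *\<^sub>R J"
  shows "C \<subseteq> K"
proof (rule ccontr)
  assume "\<not> C \<subseteq> K"
  then obtain P where PC: "P \<in> C" and PK: "P \<notin> K" by blast
  then obtain e where e: "e > 0" "\<And>X. X \<in> E \<Longrightarrow> dist X P < e \<Longrightarrow> X \<in> C"
    using bd frontier_of_closed_iff[OF C(2) CE, of P] by blast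
  have P: "P \<in> E" using PC CE by blast
  have Cadd: "X + Y \<in> C" if "X \<in> C" "Y \<in> C" for X Y
    using convex_cone_add C(1) that by blast
  have Cscale: "c *\<^sub>R X \<in> C" if "X \<in> C" "c \<ge> 0" for X c
    using convex_cone_scaleR C(1) that by blast
  have P0: "P \<noteq> 0"
  proof
    assume "P = 0"
    \<comment> \<open>If 0 were interior, a short multiple of \<open>J\<close> and its negative
      would both lie in \<open>C\<close>.\<close>
    define s where "s = e / (2 * norm J)"
    have s: "s > 0" "s * norm J < e"
      using e(1) J(2) by (auto simp: s_def field_simps)
    have "J \<in> E" using J KC CE by blast
    then have "s *\<^sub>R J \<in> C" "- (s *\<^sub>R J) \<in> C"
      using e(2) \<open>P = 0\<close> s E by (auto simp: subspace_scale subspace_neg)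
    then show False using pointed[of "s *\<^sub>R J"] s(1) J(2) by simp
  qed
  then have nP: "- P \<notin> C" using pointed PC by blast
  \<comment> \<open>A ball around \<open>- P\<close> that misses \<open>C\<close> will bound
    \<open>T X\<close> from below.\<close>
  have "open (- C)" using C(2) by (simp add: open_Compl)
  then obtain d where d: "d > 0" "\<And>Y. dist Y (- P) < d \<Longrightarrow> Y \<notin> C"
    using nP unfolding open_dist by (metis ComplD ComplI)
  txt \<open>\<open>R\<close> projects onto the frontier along \<open>P\<close>: \<open>g X\<close> is the least \<open>t\<close> with \<open>X + t P \<in> C\<close>.\<close>
  define T where "T X = {t. X + t *\<^sub>R P \<in> C}" for X
  define g where "g X = Inf (T X)" for X
  \<comment> \<open>For large \<open>t\<close>, \<open>X + t P\<close> is \<open>t\<close> times a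
    point of the \<open>e\<close>-ball around \<open>P\<close>; for very negative \<open>t\<close>
    it is \<open>- t\<close> times a point of the \<open>d\<close>-ball around
    \<open>- P\<close>.\<close>
  have Tup: "t \<in> T X" if "X \<in> E" "t > norm X / e" for X t
  proof -
    have t: "t > 0" using that(2) e(1) by (meson divide_nonneg_pos norm_ge_zero order_le_less_trans)
    have "norm ((1/t) *\<^sub>R X) < e" using that(2) t e(1) by (simp add: field_simps)
    moreover have "(1/t) *\<^sub>R X + P \<in> E" using E that(1) P(1) by (simp add: subspace_add subspace_scale)
    ultimately have "(1/t) *\<^sub>R X + P \<in> C" using e(2) by (simp add: dist_norm)
    from Cscale[OF this, of t] show ?thesis using t by (simp add: T_def algebra_simps)
  qed
  have Tlow: "- (norm X / d) \<le> t" if "t \<in> T X" for X t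
  proof (rule ccontr)
    assume "\<not> - (norm X / d) \<le> t"
    then have s: "- t > norm X / d" by simp
    then have t: "- t > 0" using d(1) by (meson divide_nonneg_pos norm_ge_zero order_le_less_trans)
    have "norm X / (-t) < d" using s t d(1) by (simp add: field_simps)
    then have "norm ((1/(-t)) *\<^sub>R X) < d" using t by simp
    then have "(1/(-t)) *\<^sub>R X - P \<notin> C" using d(2)[of "(1/(-t)) *\<^sub>R X - P"] by (simp add: dist_norm)
    moreover have "(1/(-t)) *\<^sub>R (X + t *\<^sub>R P) \<in> C"
      using that t by (intro Cscale) (auto simp: T_def)
    moreover have "(1/(-t)) *\<^sub>R (X + t *\<^sub>R P) = (1/(-t)) *\<^sub>R X - P"
      using t by (simp add: scaleR_add_right)
    ultimately show False by simp
  qed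
  have Tbdd: "bdd_below (T X)" for X using Tlow by (metis bdd_belowI)
  have Tne: "T X \<noteq> {}" if "X \<in> E" for X
    using Tup[OF that, of "norm X / e + 1"] by auto
  have Tcl: "closed (T X)" for X
  proof -
    have "T X = (\<lambda>t. X + t *\<^sub>R P) -` C" by (auto simp: T_def)
    then show ?thesis using C(2) by (auto intro!: closed_vimage continuous_intros)
  qed
  have gT: "g X \<in> T X" if "X \<in> E" for X
    unfolding g_def by (rule closed_contains_Inf[OF Tne[OF that] Tbdd Tcl])
  have g_le: "g X \<le> t" if "t \<in> T X" for X t
    unfolding g_def using cInf_lower[OF that Tbdd] .
  have g_diff: "g X \<le> g Y + norm (X - Y) / e" if "X \<in> E" "Y \<in> E" for X Y
  proof (rule dense_ge)
    fix u assume "g Y + norm (X - Y) / e < u"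
    then have "u - g Y \<in> T (X - Y)"
      using that E by (intro Tup) (auto simp: subspace_diff)
    then have "X - Y + (u - g Y) *\<^sub>R P \<in> C" "Y + g Y *\<^sub>R P \<in> C"
      using gT[OF that(2)] by (auto simp: T_def)
    from Cadd[OF this] have "u \<in> T X" by (simp add: T_def algebra_simps)
    then show "g X \<le> u" by (rule g_le)
  qed
  have g_cont: "continuous_on E g"
  proof -
    have "(1 / e)-lipschitz_on E g"
    proof (rule lipschitz_onI)
      fix X Y assume "X \<in> E" "Y \<in> E"
      then show "dist (g X) (g Y) \<le> 1 / e * dist X Y"
        using g_diff[of X Y] g_diff[of Y X]
        by (auto simp: dist_norm norm_minus_commute)
    qed (use e in auto)
    then show ?thesis by (rule lipschitz_on_continuous_on)
  qed
  define R where "R X = X + g X *\<^sub>R P" for X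
  have R_K: "R X \<in> K" if "X \<in> E" for X
  proof -
    have RC: "R X \<in> C" using gT[OF that] by (simp add: T_def R_def)
    have "\<not> (\<exists>r>0. \<forall>y\<in>E. dist y (R X) < r \<longrightarrow> y \<in> C)"
    proof safe
      fix r :: real assume r: "r > 0" "\<forall>y\<in>E. dist y (R X) < r \<longrightarrow> y \<in> C"
      \<comment> \<open>A step shorter than \<open>r\<close> along \<open>- P\<close> would stay in
        \<open>C\<close> and undercut \<open>g X\<close>.\<close>
      define s where "s = r / (2 * norm P)"
      have s: "s > 0" "s * norm P < r" using r P0 by (auto simp: s_def field_simps)
      have "R X - s *\<^sub>R P \<in> E" using RC CE P E by (auto intro: subspace_diff subspace_scale)
      then have "R X - s *\<^sub>R P \<in> C" using r(2) s by (simp add: dist_norm)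
      then have "g X - s \<in> T X" by (simp add: T_def R_def algebra_simps)
      from g_le[OF this] show False using s by simp
    qed
    then show ?thesis using frontier_of_closed_iff[OF C(2) CE] RC bd by blast
  qed
  have R_cont: "continuous_on E R"
    unfolding R_def by (intro continuous_intros g_cont)
  \<comment> \<open>The orthogonal projection that kills \<open>P\<close>. It undoes
    \<open>R\<close> on \<open>H\<close>, because \<open>R\<close> moves points along
    \<open>P\<close> only.\<close>
  define q where "q Y = Y - ((Y \<bullet> P) / (P \<bullet> P)) *\<^sub>R P" for Y
  have q_scale: "q (s *\<^sub>R Y) = s *\<^sub>R q Y" for s Y
    by (simp add: q_def algebra_simps)
  have q_orth: "q Y \<bullet> P = 0" for Y
    using P0 by (simp add: q_def inner_diff_left)
  have q_E: "q Y \<in> E" if "Y \<in> E" for Y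
    unfolding q_def using that P E by (simp add: subspace_diff subspace_scale)
  have q_cont: "continuous_on S q" for S
    unfolding q_def by (intro continuous_intros) (use P0 in auto)
  \<comment> \<open>Otherwise \<open>Y = c P\<close>: a positive \<open>c\<close> would put
    \<open>P\<close> into \<open>K\<close> by scaling, a negative one would put \<open>- P\<close>
    into \<open>C\<close>.\<close>
  have q_K: "q Y \<noteq> 0" if "Y \<in> K" "Y \<noteq> 0" for Y
  proof
    assume "q Y = 0"
    then obtain c where c: "Y = c *\<^sub>R P" unfolding q_def by auto
    consider "c > 0" | "c = 0" | "c < 0" by linarith
    then show False
    proof cases
      case 1
      then have "P = (1/c) *\<^sub>R Y" using c by simp
      then show False using K[OF that(1), of "1/c"] 1 PK by simp
    next
      case 2
      then show False using c that by simp
    next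
      case 3
      then have "- P = (1/(-c)) *\<^sub>R Y" using c by simp
      then show False using Cscale[of Y "1/(-c)"] 3 nP that KC by auto
    qed
  qed
  define H where "H = {X \<in> E. X \<bullet> P = 0}"
  have R_nz: "R X \<noteq> 0" if "X \<in> H" "X \<noteq> 0" for X
  proof
    assume "R X = 0"
    then have "R X \<bullet> P = 0" by simp
    then have "g X = 0" using that P0 by (simp add: R_def H_def inner_add_left)
    then show False using \<open>R X = 0\<close> that by (simp add: R_def)
  qed
  define D where "D = H \<inter> cball 0 1"
  \<comment> \<open>The time is 0 on the unit sphere, where \<open>f X = X\<close>, and 1 at radius
    1/2, where \<open>f X\<close> is a positive multiple of \<open>q J\<close>.\<close>
  define f where "f X = q (h (2 - 2 * norm X) (R X))" for X
  txt \<open>Up to the sign, \<open>F\<close> is the identity on the unit sphere of the hyperplane \<open>H\<close> and runs through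
    the contraction on the shell \<open>1/2 \<le> norm X \<le> 1\<close>. The sign rules out a fixed point.\<close>
  define F where "F X = (if norm X \<le> 1/2 then - sgn (q J) else - sgn (f X))" for X
  have H_sub: "subspace H"
    using E by (auto simp: H_def subspace_def inner_add_left)
  have q_nz: "q Y \<noteq> 0 \<and> q Y \<in> H" if "Y \<in> K" "Y \<noteq> 0" for Y
  proof -
    have "Y \<in> E" using that KC CE by blast
    then show ?thesis using q_K[OF that] q_E q_orth by (simp add: H_def)
  qed
  have f_good: "f X \<noteq> 0 \<and> f X \<in> H" if "X \<in> H" "1/2 \<le> norm X" "norm X \<le> 1" for X
  proof -
    have "X \<noteq> 0" "X \<in> E" using that by (auto simp: H_def)
    then have "h (2 - 2 * norm X) (R X) \<in> K - {0}"
      using that R_nz[OF that(1)] R_K by (intro hK) simp_all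
    then show ?thesis using q_nz unfolding f_def by simp
  qed
  have qJ: "q J \<noteq> 0" "q J \<in> H"
    using q_nz J by simp_all
  have "continuous_on D F"
    unfolding F_def
  proof (rule continuous_on_cases_le)
    have "continuous_on {X \<in> D. 1/2 \<le> norm X} (\<lambda>X. (2 - 2 * norm X, R X))"
      by (intro continuous_intros continuous_on_subset[OF R_cont]) (auto simp: D_def H_def)
    then have "continuous_on {X \<in> D. 1/2 \<le> norm X} (\<lambda>X. h (2 - 2 * norm X) (R X))"
      using continuous_on_compose2[OF h, of _ "\<lambda>X. (2 - 2 * norm X, R X)"] by auto
    then have "continuous_on {X \<in> D. 1/2 \<le> norm X} f"
      unfolding f_def using continuous_on_compose2[OF q_cont[of UNIV]] by auto
    then show "continuous_on {X \<in> D. 1/2 \<le> norm X} (\<lambda>X. - sgn (f X))"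
      using f_good by (intro continuous_intros) (auto simp: D_def)
    \<comment> \<open>The two pieces agree at radius 1/2 because \<open>sgn\<close> forgets the
      positive factor \<open>s\<close>.\<close>
    show "- sgn (q J) = - sgn (f X)" if "X \<in> D" "norm X = 1/2" for X
    proof -
      have X: "X \<in> H" "X \<noteq> 0" "X \<in> E" using that by (auto simp: D_def H_def)
      then obtain s where "s > 0" "h 1 (R X) = s *\<^sub>R J" using h1[OF R_K R_nz] by blast
      moreover have "2 - 2 * norm X = 1" using that(2) by simp
      ultimately have "f X = s *\<^sub>R q J" by (simp add: f_def q_scale)
      then show ?thesis using \<open>s > 0\<close> by (simp add: sgn_scaleR)
    qed
  qed (auto intro!: continuous_intros)
  moreover have "F \<in> D \<rightarrow> D"
  proof
    have *: "- sgn Y \<in> D" if "Y \<in> H" for Y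
    proof -
      have "sgn Y \<in> H" using H_sub that by (simp add: sgn_div_norm subspace_scale)
      moreover have "norm (sgn Y) \<le> 1" by (simp add: norm_sgn)
      ultimately show ?thesis using H_sub by (simp add: D_def subspace_neg)
    qed
    fix X assume "X \<in> D"
    then have "X \<in> H" "norm X \<le> 1" by (auto simp: D_def)
    then show "F X \<in> D"
      using *[OF qJ(2)] *[of "f X"] f_good[of X] by (cases "norm X \<le> 1/2") (simp_all add: F_def)
  qed
  moreover have "compact D"
    unfolding D_def using H_sub by (intro closed_Int_compact closed_subspace compact_cball)
  moreover have "convex D"
    unfolding D_def using H_sub by (intro convex_Int subspace_imp_convex convex_cball)
  moreover have "D \<noteq> {}"
    using subspace_0[OF H_sub] unfolding D_def by force
  ultimately obtain X where X: "X \<in> D" "F X = X" using brouwer[of D F] by metis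
  \<comment> \<open>All values of \<open>F\<close> on \<open>D\<close> are unit vectors, so the
    fixed point lies on the unit sphere, where \<open>F\<close> is the antipodal map.\<close>
  have "norm (F X) = 1"
    using X(1) qJ f_good[of X] by (auto simp: F_def D_def norm_sgn)
  then have n: "norm X = 1" using X by simp
  have "f X = X"
    using X(1) n P0 by (simp add: f_def h0 q_def R_def D_def H_def inner_add_left)
  then have "- X = X" using X(2) n by (simp add: F_def sgn_div_norm)
  then have "X + X = 0" by (metis add.left_inverse)
  then have "2 *\<^sub>R X = 0" by (simp only: scaleR_2)
  then show False using n by simp
qed

section \<open>The completely positive cone\<close>

text \<open>The set \<open>K\<^sub>m\<close> of the overview, free of the case distinctions in
  \<open>cp_rank\<close>; \<open>cp_rank_le_iff\<close> connects the two.\<close>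

definition cp_factorizable :: "nat \<Rightarrow> (real^'n^'n) set" where
  "cp_factorizable m = {M. \<exists>V. cp_factorization M m V}"

lemma cp_cone_eq_UN: "cp_cone = (\<Union>m. cp_factorizable m)"
  by (auto simp: cp_cone_def completely_positive_def cp_factorizable_def)

lemma cp_factorizable_subset_cp_cone: "cp_factorizable m \<subseteq> cp_cone"
  by (auto simp: cp_cone_eq_UN)

lemma zero_in_cp_factorizable: "0 \<in> cp_factorizable m"
proof -
  have "cp_factorization 0 m (\<lambda>_ _. 0)"
    by (simp add: cp_factorization_def vec_eq_iff)
  then show ?thesis by (auto simp: cp_factorizable_def)
qed

lemma sum_lessThan_add:
  fixes f :: "nat \<Rightarrow> 'a::comm_monoid_add"
  shows "(\<Sum>l<a + b. f l) = (\<Sum>l<a. f l) + (\<Sum>l<b. f (a + l))"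
  by (induction b) (simp_all add: add.assoc)

lemma cp_factorizable_add:
  assumes "M \<in> cp_factorizable a" "N \<in> cp_factorizable b"
  shows "M + N \<in> cp_factorizable (a + b)"
proof -
  obtain V W where V: "cp_factorization M a V" and W: "cp_factorization N b W"
    using assms by (auto simp: cp_factorizable_def)
  have "cp_factorization (M + N) (a + b) (\<lambda>i l. if l < a then V i l else W i (l - a))"
    using V W by (auto simp: cp_factorization_def vec_eq_iff sum_lessThan_add)
  then show ?thesis by (auto simp: cp_factorizable_def)
qed

text \<open>Pad the factor with zero columns.\<close>

lemma cp_factorizable_mono: "a \<le> b \<Longrightarrow> cp_factorizable a \<subseteq> cp_factorizable b"
  using cp_factorizable_add[OF _ zero_in_cp_factorizable[of "b - a"], of _ a] by auto

lemma cp_factorizable_scaleR: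
  assumes "M \<in> cp_factorizable m" "c \<ge> 0"
  shows "c *\<^sub>R M \<in> cp_factorizable m"
proof -
  obtain V where V: "cp_factorization M m V"
    using assms by (auto simp: cp_factorizable_def)
  have eq: "sqrt c * x * (sqrt c * y) = c * (x * y)" for x y
    using assms(2) by (simp add: mult.assoc mult.left_commute[of x] flip: mult.assoc[of "sqrt c" "sqrt c"])
  then have "cp_factorization (c *\<^sub>R M) m (\<lambda>i l. sqrt c * V i l)"
    using V assms(2) by (auto simp: cp_factorization_def vec_eq_iff sum_distrib_left eq)
  then show ?thesis by (auto simp: cp_factorizable_def)
qed

lemma cp_factorizable_sum:
  "finite S \<Longrightarrow> (\<And>x. x \<in> S \<Longrightarrow> f x \<in> cp_factorizable 1) \<Longrightarrow> sum f S \<in> cp_factorizable (card S)"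
proof (induction S rule: finite_induct)
  case empty
  then show ?case by (simp add: zero_in_cp_factorizable)
next
  case (insert x S)
  then have "f x + sum f S \<in> cp_factorizable (1 + card S)"
    by (intro cp_factorizable_add) auto
  then show ?case using insert by simp
qed

text \<open>Both sides hold for the zero matrix and fail outside the cone. Otherwise padding makes
  the possible numbers of columns upward closed from the least one.\<close>

lemma cp_rank_le_iff: "cp_rank M \<le> enat m \<longleftrightarrow> M \<in> cp_factorizable m"
proof (cases "M = 0 \<or> \<not> completely_positive M")
  case True
  then show ?thesis
    using zero_in_cp_factorizable
    by (auto simp: cp_rank_def cp_factorizable_def completely_positive_def simp flip: zero_enat_def)
next
  case False
  then obtain a where a: "M \<in> cp_factorizable a"
    by (auto simp: completely_positive_def cp_factorizable_def)
  have r: "cp_rank M = enat (LEAST a. M \<in> cp_factorizable a)"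
    using False by (auto simp: cp_rank_def cp_factorizable_def)
  have "M \<in> cp_factorizable (LEAST a. M \<in> cp_factorizable a)"
    using a by (rule LeastI)
  then have "(LEAST a. M \<in> cp_factorizable a) \<le> m \<longleftrightarrow> M \<in> cp_factorizable m"
    using cp_factorizable_mono by (auto intro: Least_le)
  then show ?thesis by (simp add: r)
qed

lemma convex_cone_cp_cone: "convex_cone cp_cone"
  unfolding convex_cone_iff cp_cone_eq_UN
proof (intro conjI ballI allI impI)
  fix M N :: "real^'n^'n" and c :: real
  assume "M \<in> (\<Union>m. cp_factorizable m)"
  then obtain a where a: "M \<in> cp_factorizable a" by blast
  show "c *\<^sub>R M \<in> (\<Union>m. cp_factorizable m)" if "0 \<le> c"
    using cp_factorizable_scaleR[OF a that] by blast
  assume "N \<in> (\<Union>m. cp_factorizable m)"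
  then obtain b where "N \<in> cp_factorizable b" by blast
  from cp_factorizable_add[OF a this] show "M + N \<in> (\<Union>m. cp_factorizable m)" by blast
qed (use zero_in_cp_factorizable in blast)

lemma cp_cone_nonneg: "M \<in> cp_cone \<Longrightarrow> 0 \<le> M $ i $ j"
  by (auto simp: cp_cone_def completely_positive_def cp_factorization_def intro!: sum_nonneg)

lemma cp_cone_symmetric: "cp_cone \<subseteq> symmetric_matrices"
  by (auto simp: cp_cone_def completely_positive_def cp_factorization_def symmetric_matrices_def
      transpose_def vec_eq_iff mult.commute)

section \<open>Closedness of the cone and a finite bound on the cp-rank\<close>

definition outer :: "real^'n \<Rightarrow> real^'n^'n" where
  "outer v = (\<chi> i j. v $ i * v $ j)"

text \<open>The vectors are normalised so that the generators form a compact set of trace-one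
  matrices.\<close>

definition cp_generators :: "(real^'n^'n) set" where
  "cp_generators = outer ` ({v. \<forall>i. 0 \<le> v $ i} \<inter> sphere 0 1)"

lemma outer_in_cp_factorizable:
  assumes "\<And>i. 0 \<le> v $ i"
  shows "outer v \<in> cp_factorizable 1"
proof -
  have "cp_factorization (outer v) 1 (\<lambda>i _. v $ i)"
    using assms by (simp add: cp_factorization_def outer_def)
  then show ?thesis by (auto simp: cp_factorizable_def)
qed

lemma compact_cp_generators: "compact (cp_generators :: (real^'n^'n) set)"
proof -
  have "{v :: real^'n. \<forall>i. 0 \<le> v $ i} = (\<Inter>i. {v. 0 \<le> v $ i})" by auto
  moreover have "closed {v :: real^'n. 0 \<le> v $ i}" for i
    by (intro closed_Collect_le continuous_intros)
  ultimately have "closed {v :: real^'n. \<forall>i. 0 \<le> v $ i}" by auto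
  then show ?thesis
    unfolding cp_generators_def outer_def
    by (intro compact_continuous_image closed_Int_compact compact_sphere continuous_intros)
qed

text \<open>The trace is linear and equals 1 on all generators.\<close>

lemma zero_notin_convex_hull_cp_generators:
  "0 \<notin> convex hull (cp_generators :: (real^'n^'n) set)"
proof -
  define D :: "(real^'n^'n) set" where "D = {M. (\<Sum>i\<in>UNIV. M $ i $ i) = 1}"
  have "convex D"
    by (auto simp: D_def convex_def sum.distrib simp flip: sum_distrib_left)
  moreover have "cp_generators \<subseteq> D"
    by (auto simp: cp_generators_def D_def outer_def norm_eq_1 inner_vec_def)
  ultimately have "convex hull cp_generators \<subseteq> D" by (rule hull_minimal[rotated])
  then show ?thesis by (auto simp: D_def)
qed

lemma cp_generators_nonempty: "(cp_generators :: (real^'n^'n) set) \<noteq> {}"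
proof -
  have "axis i 1 \<in> {v :: real^'n. \<forall>i. 0 \<le> v $ i} \<inter> sphere 0 1" for i
    by (simp add: axis_def norm_axis_1[unfolded axis_def])
  then show ?thesis unfolding cp_generators_def by blast
qed

lemma outer_in_convex_cone_hull:
  assumes "\<And>i. 0 \<le> v $ i"
  shows "outer v \<in> convex_cone hull cp_generators"
proof (cases "v = 0")
  case True
  then have "outer v = 0" by (simp add: outer_def vec_eq_iff)
  then show ?thesis by (simp add: convex_cone_hull_contains_0)
next
  case False
  then have "outer (v /\<^sub>R norm v) \<in> cp_generators"
    using assms by (auto simp: cp_generators_def intro!: imageI)
  \<comment> \<open>\<open>outer\<close> is quadratic, so undoing the normalisation costs the factor
    \<open>(norm v)\<^sup>2\<close>.\<close>
  then have "(norm v)\<^sup>2 *\<^sub>R outer (v /\<^sub>R norm v) \<in> convex_cone hull cp_generators"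
    by (intro convex_cone_hull_mul hull_inc) auto
  moreover have "(norm v)\<^sup>2 *\<^sub>R outer (v /\<^sub>R norm v) = outer v"
    using False by (simp add: outer_def vec_eq_iff power2_eq_square field_simps)
  ultimately show ?thesis by simp
qed

lemma cp_cone_subset_convex_cone_hull: "cp_cone \<subseteq> convex_cone hull cp_generators"
proof
  fix M :: "real^'n^'n" assume "M \<in> cp_cone"
  then obtain m and V :: "'n \<Rightarrow> nat \<Rightarrow> real"
    where V: "\<forall>i. \<forall>l<m. 0 \<le> V i l" "M = (\<chi> i j. \<Sum>l<m. V i l * V j l)"
    unfolding cp_cone_def completely_positive_def cp_factorization_def by blast
  \<comment> \<open>Columns of \<open>V\<close> are known to be nonnegative only below
    \<open>m\<close>, hence the guard on \<open>k\<close>.\<close>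
  have "k \<le> m \<Longrightarrow> (\<Sum>l<k. outer (\<chi> i. V i l)) \<in> convex_cone hull cp_generators" for k
  proof (induction k)
    case (Suc k)
    then show ?case
      using V(1) by (auto intro!: convex_cone_hull_add outer_in_convex_cone_hull)
  qed (simp add: convex_cone_hull_contains_0)
  moreover have "(\<Sum>l<m. outer (\<chi> i. V i l)) = M"
    by (simp add: V(2) outer_def vec_eq_iff)
  ultimately show "M \<in> convex_cone hull cp_generators" by auto
qed

lemma cp_generators_subset: "cp_generators \<subseteq> cp_factorizable 1"
  unfolding cp_generators_def using outer_in_cp_factorizable by blast

lemma cp_cone_eq_hull: "cp_cone = conic hull (convex hull cp_generators)"
proof -
  have "convex_cone hull cp_generators \<subseteq> cp_cone"
    using cp_generators_subset cp_factorizable_subset_cp_cone convex_cone_cp_cone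
    by (intro hull_minimal) (rule subset_trans)
  then have "cp_cone = convex_cone hull cp_generators"
    using cp_cone_subset_convex_cone_hull by (rule subset_antisym[rotated])
  then show ?thesis
    by (simp add: convex_cone_hull_separate_nonempty cp_generators_nonempty)
qed

text \<open>The conic hull of a compact set that avoids 0 is closed.\<close>

lemma closed_cp_cone: "closed (cp_cone :: (real^'n^'n) set)"
  unfolding cp_cone_eq_hull
  using compact_convex_hull[OF compact_cp_generators] zero_notin_convex_hull_cp_generators
  by (intro closed_conic_hull) blast

text \<open>A convex combination of at most \<open>DIM(real^'n^'n) + 1\<close> generators suffices,
  and each weighted generator contributes one column. The bound is crude, but only its finiteness
  matters.\<close>

lemma cp_cone_caratheodory:
  "(cp_cone :: (real^'n^'n) set) = cp_factorizable (DIM(real^'n^'n) + 1)"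
proof (rule subset_antisym)
  let ?d = "DIM(real^'n^'n) + 1"
  have "convex hull cp_generators \<subseteq> (cp_factorizable ?d :: (real^'n^'n) set)"
  proof
    fix M :: "real^'n^'n" assume "M \<in> convex hull cp_generators"
    then obtain S u where S: "finite S" "S \<subseteq> cp_generators" "card S \<le> ?d" "\<And>x. x \<in> S \<Longrightarrow> 0 \<le> u x"
      and M: "(\<Sum>x\<in>S. u x *\<^sub>R x) = M"
      by (subst (asm) convex_hull_caratheodory) blast
    have "(\<Sum>x\<in>S. u x *\<^sub>R x) \<in> cp_factorizable (card S)"
      using S cp_generators_subset by (intro cp_factorizable_sum cp_factorizable_scaleR) auto
    then show "M \<in> cp_factorizable ?d"
      using M S(3) cp_factorizable_mono by blast
  qed
  then show "cp_cone \<subseteq> (cp_factorizable ?d :: (real^'n^'n) set)"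
    by (auto simp: cp_cone_eq_hull conic_hull_explicit intro!: cp_factorizable_scaleR)
qed (rule cp_factorizable_subset_cp_cone)

text \<open>The uniform bound makes the set of cp-ranks finite, so \<open>Max\<close> is a genuine
  maximum.\<close>

lemma max_cp_rank_attained:
  "\<exists>M :: real^'n^'n. M \<in> cp_cone \<and> cp_rank M = max_cp_rank TYPE('n)"
  and max_cp_rank_ge: "M \<in> (cp_cone :: (real^'n^'n) set) \<Longrightarrow> cp_rank M \<le> max_cp_rank TYPE('n)"
proof -
  have "cp_rank ` (cp_cone :: (real^'n^'n) set) \<subseteq> {..enat (DIM(real^'n^'n) + 1)}"
    unfolding cp_cone_caratheodory using cp_rank_le_iff by blast
  then have fin: "finite (cp_rank ` (cp_cone :: (real^'n^'n) set))"
    by (intro finite_enat_bounded[where n = "DIM(real^'n^'n) + 1"]) blast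
  have "cp_rank ` (cp_cone :: (real^'n^'n) set) \<noteq> {}"
    using zero_in_cp_factorizable cp_factorizable_subset_cp_cone by blast
  from Max_in[OF fin this]
  show "\<exists>M :: real^'n^'n. M \<in> cp_cone \<and> cp_rank M = max_cp_rank TYPE('n)"
    unfolding max_cp_rank_def by (auto dest: sym)
  show "cp_rank M \<le> max_cp_rank TYPE('n)" if "M \<in> (cp_cone :: (real^'n^'n) set)"
    unfolding max_cp_rank_def using that fin by (intro Max_ge) auto
qed

section \<open>Boundary matrices\<close>

lemma cp_factorizable_split:
  assumes "M \<in> cp_factorizable (a + b)"
  obtains A B where "A \<in> cp_factorizable a" "B \<in> cp_factorizable b" "M = A + B"
proof -
  obtain V where V: "cp_factorization M (a + b) V"
    using assms by (auto simp: cp_factorizable_def)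
  let ?A = "\<chi> i j. \<Sum>l<a. V i l * V j l" and ?B = "\<chi> i j. \<Sum>l<b. V i (a + l) * V j (a + l)"
  have "cp_factorization ?A a V" "cp_factorization ?B b (\<lambda>i l. V i (a + l))"
    using V by (auto simp: cp_factorization_def)
  moreover have "M = ?A + ?B"
    using V by (simp add: cp_factorization_def vec_eq_iff sum_lessThan_add)
  ultimately show ?thesis using that by (auto simp: cp_factorizable_def)
qed

text \<open>If \<open>V\<close> factors \<open>M\<close>, then \<open>A V\<close> factors the
  congruent matrix, with the same number of columns and no negative entries.\<close>

lemma cp_factorizable_congruence:
  assumes "M \<in> cp_factorizable m" "\<And>i j. 0 \<le> A $ i $ j"
  shows "A ** M ** transpose A \<in> cp_factorizable m"
proof -
  obtain V where V: "\<forall>i. \<forall>l<m. 0 \<le> V i l" "M = (\<chi> i j. \<Sum>l<m. V i l * V j l)"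
    using assms(1) by (auto simp: cp_factorizable_def cp_factorization_def)
  have "(A ** M ** transpose A) $ i $ j = (\<Sum>l<m. (\<Sum>a\<in>UNIV. A $ i $ a * V a l) * (\<Sum>b\<in>UNIV. A $ j $ b * V b l))" for i j
  proof -
    have "(A ** M ** transpose A) $ i $ j = (\<Sum>b\<in>UNIV. \<Sum>a\<in>UNIV. \<Sum>l<m. A $ i $ a * V a l * (A $ j $ b * V b l))"
      by (simp add: matrix_matrix_mult_def transpose_def V(2) sum_distrib_left sum_distrib_right mult_ac)
    also have "\<dots> = (\<Sum>b\<in>UNIV. \<Sum>l<m. \<Sum>a\<in>UNIV. A $ i $ a * V a l * (A $ j $ b * V b l))"
      by (subst (2) sum.swap) (rule refl)
    also have "\<dots> = (\<Sum>l<m. \<Sum>b\<in>UNIV. \<Sum>a\<in>UNIV. A $ i $ a * V a l * (A $ j $ b * V b l))"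
      by (rule sum.swap)
    also have "\<dots> = (\<Sum>l<m. \<Sum>a\<in>UNIV. \<Sum>b\<in>UNIV. A $ i $ a * V a l * (A $ j $ b * V b l))"
      by (subst (2) sum.swap) (rule refl)
    finally show ?thesis by (simp add: sum_product)
  qed
  then have "cp_factorization (A ** M ** transpose A) m (\<lambda>i l. \<Sum>a\<in>UNIV. A $ i $ a * V a l)"
    using V(1) assms(2) by (auto simp: cp_factorization_def vec_eq_iff intro!: sum_nonneg)
  then show ?thesis by (auto simp: cp_factorizable_def)
qed

text \<open>Nothing can cancel among nonnegative terms, so a positive entry of \<open>M\<close>
  survives through the positive diagonal of \<open>A\<close>.\<close>

lemma congruence_nonzero:
  assumes "M \<in> cp_cone" "M \<noteq> 0" "\<And>i j. 0 \<le> A $ i $ j" "\<And>i. A $ i $ i > 0"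
  shows "A ** M ** transpose A \<noteq> 0"
proof -
  obtain a b where "M $ a $ b \<noteq> 0" using assms(2) by (auto simp: vec_eq_iff)
  then have "0 < A $ a $ a * M $ a $ b * A $ b $ b"
    using cp_cone_nonneg[OF assms(1), of a b] assms(4) by simp
  also have "\<dots> \<le> (\<Sum>c\<in>UNIV. A $ a $ c * M $ c $ b) * A $ b $ b"
    using assms(3) cp_cone_nonneg[OF assms(1)]
    by (intro mult_right_mono member_le_sum mult_nonneg_nonneg) auto
  also have "\<dots> \<le> (\<Sum>d\<in>UNIV. (\<Sum>c\<in>UNIV. A $ a $ c * M $ c $ d) * A $ b $ d)"
    using assms(3) cp_cone_nonneg[OF assms(1)]
    by (intro member_le_sum[where f = "\<lambda>d. (\<Sum>c\<in>UNIV. A $ a $ c * M $ c $ d) * A $ b $ d"]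
        mult_nonneg_nonneg sum_nonneg) auto
  also have "\<dots> = (A ** M ** transpose A) $ a $ b"
    by (simp add: matrix_matrix_mult_def transpose_def)
  finally show ?thesis by auto
qed

section \<open>The maximal cp-rank on the boundary\<close>

lemma cp_boundary_iff:
  "M \<in> cp_boundary \<longleftrightarrow> M \<in> cp_cone \<and>
     \<not> (\<exists>e>0. \<forall>N\<in>symmetric_matrices. dist N M < e \<longrightarrow> N \<in> cp_cone)"
  unfolding cp_boundary_def by (rule frontier_of_closed_iff[OF closed_cp_cone cp_cone_symmetric])

lemma subspace_symmetric_matrices: "subspace symmetric_matrices"
  by (auto simp: subspace_def symmetric_matrices_def transpose_def vec_eq_iff)

lemma cp_cone_subset_if_cp_boundary_subset:
  assumes bd: "(cp_boundary :: (real^'n^'n) set) \<subseteq> cp_factorizable m" and m: "m \<ge> 1"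
  shows "(cp_cone :: (real^'n^'n) set) \<subseteq> cp_factorizable m"
proof -
  \<comment> \<open>The path from the identity at \<open>t = 0\<close> to the all-ones matrix at
    \<open>t = 1\<close>; its diagonal stays 1, as \<open>congruence_nonzero\<close>
    requires.\<close>
  define A :: "real \<Rightarrow> real^'n^'n" where "A t = (\<chi> i j. (if i = j then 1 else t))" for t
  define J :: "real^'n^'n" where "J = outer (\<chi> i. 1)"
  \<comment> \<open>\<open>J\<close> has a single-column factorization; this is where
    \<open>m \<ge> 1\<close> enters.\<close>
  have J: "J \<in> cp_factorizable m"
    using outer_in_cp_factorizable[of "\<chi> i. 1"] cp_factorizable_mono[OF m] by (auto simp: J_def)
  have J0: "J \<noteq> 0" by (simp add: J_def outer_def vec_eq_iff)
  show ?thesis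
  proof (rule pointed_cone_subset_if_frontier_contracts[OF subspace_symmetric_matrices
        cp_cone_symmetric convex_cone_cp_cone closed_cp_cone])
    show "X = 0" if "X \<in> cp_cone" "- X \<in> cp_cone" for X :: "real^'n^'n"
      using that[THEN cp_cone_nonneg] by (auto simp: vec_eq_iff intro: antisym)
    show "top_of_set symmetric_matrices frontier_of cp_cone \<subseteq> (cp_factorizable m :: (real^'n^'n) set)"
      using bd by (simp add: cp_boundary_def)
    show "continuous_on UNIV (\<lambda>(t, N :: real^'n^'n). A t ** N ** transpose (A t))"
    proof -
      have "continuous_on UNIV (\<lambda>x :: real \<times> (real^'n^'n). if P then 1 else fst x)" for P
        by (cases P) (auto intro: continuous_intros)
      then show ?thesis
        unfolding matrix_matrix_mult_def transpose_def A_def split_def vec_lambda_beta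
        by (intro continuous_intros) auto
    qed
    show "A t ** N ** transpose (A t) \<in> cp_factorizable m - {0}"
      if t: "0 \<le> t" and N: "N \<in> cp_factorizable m" "N \<noteq> 0" for t N
    proof -
      have "0 \<le> A t $ i $ j" "0 < A t $ i $ i" for i j
        using t by (simp_all add: A_def)
      moreover have "N \<in> cp_cone"
        using N(1) cp_factorizable_subset_cp_cone by blast
      ultimately show ?thesis
        using N cp_factorizable_congruence[of N m "A t"] congruence_nonzero[of N "A t"] by simp
    qed
    show "A 0 ** N ** transpose (A 0) = N" for N
    proof -
      have "A 0 = mat 1" by (simp add: A_def mat_def)
      then show ?thesis by (simp add: transpose_mat)
    qed
    show "\<exists>s>0. A 1 ** N ** transpose (A 1) = s *\<^sub>R J"
      if "N \<in> cp_factorizable m" "N \<noteq> 0" for N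
    proof -
      \<comment> \<open>Congruence with the all-ones matrix replaces every entry by the sum of all
        entries of \<open>N\<close>.\<close>
      let ?s = "\<Sum>b\<in>UNIV. \<Sum>a\<in>UNIV. N $ a $ b"
      have eq: "A 1 ** N ** transpose (A 1) = ?s *\<^sub>R J"
        by (simp add: A_def J_def outer_def vec_eq_iff matrix_matrix_mult_def transpose_def)
      have N: "N \<in> cp_cone" using that cp_factorizable_subset_cp_cone by blast
      have "A 1 ** N ** transpose (A 1) \<noteq> 0"
        by (rule congruence_nonzero[OF N that(2)]) (simp_all add: A_def)
      moreover have "?s \<ge> 0"
        using cp_cone_nonneg[OF N] by (intro sum_nonneg)
      ultimately have "?s > 0" using eq by auto
      then show ?thesis using eq by blast
    qed
  qed (simp_all add: J J0 cp_factorizable_subset_cp_cone cp_factorizable_scaleR)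
qed

text \<open>This keeps \<open>p - 1\<close> positive in the boundary argument. The witness is
  diagonal with ones at \<open>a\<close> and \<open>b\<close>; a single column would be nonzero at
  both, against the zero entry at \<open>(a, b)\<close>.\<close>

lemma two_le_max_cp_rank:
  assumes "CARD('n::finite) \<ge> 2"
  shows "enat 2 \<le> max_cp_rank TYPE('n)"
proof -
  obtain a b :: 'n where ab: "a \<noteq> b"
    using assms card_le_Suc0_iff_eq[of "UNIV :: 'n set"] by auto
  define M :: "real^'n^'n" where "M = outer (axis a 1) + outer (axis b 1)"
  have "M \<in> cp_factorizable (1 + 1)"
    unfolding M_def by (intro cp_factorizable_add outer_in_cp_factorizable) (auto simp: axis_def)
  then have "cp_rank M \<le> max_cp_rank TYPE('n)"
    using cp_factorizable_subset_cp_cone by (intro max_cp_rank_ge) blast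
  moreover have "M \<notin> cp_factorizable 1"
  proof
    assume "M \<in> cp_factorizable 1"
    then obtain V :: "'n \<Rightarrow> nat \<Rightarrow> real" where V: "\<And>i j. M $ i $ j = V i 0 * V j 0"
      by (auto simp: cp_factorizable_def cp_factorization_def)
    have "M $ a $ b = 0" "M $ a $ a = 1" "M $ b $ b = 1"
      using ab by (auto simp: M_def outer_def axis_def)
    then show False using V by auto
  qed
  then have "\<not> cp_rank M \<le> enat 1" using cp_rank_le_iff by blast
  then have "enat 2 \<le> cp_rank M" by (cases "cp_rank M") auto
  ultimately show ?thesis by (rule order_trans[rotated])
qed

text \<open>Otherwise \<open>p - 1\<close> columns would suffice on the boundary, hence on the whole
  cone.\<close>

lemma exists_cp_boundary_max_cp_rank:
  assumes "CARD('n::finite) \<ge> 2" and p: "max_cp_rank TYPE('n) = enat p"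
  shows "\<exists>M :: real^'n^'n. M \<in> cp_boundary \<and> cp_rank M = enat p"
proof (rule ccontr)
  assume none: "\<not> ?thesis"
  have "p \<ge> 2" using two_le_max_cp_rank[OF assms(1)] p by simp
  have "(cp_boundary :: (real^'n^'n) set) \<subseteq> cp_factorizable (p - 1)"
  proof
    fix N :: "real^'n^'n" assume N: "N \<in> cp_boundary"
    then have "cp_rank N \<le> enat p" using max_cp_rank_ge[of N] p by (simp add: cp_boundary_iff)
    moreover have "cp_rank N \<noteq> enat p" using none N by blast
    ultimately have "cp_rank N \<le> enat (p - 1)" by (cases "cp_rank N") auto
    then show "N \<in> cp_factorizable (p - 1)" using cp_rank_le_iff by blast
  qed
  then have sub: "(cp_cone :: (real^'n^'n) set) \<subseteq> cp_factorizable (p - 1)"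
    by (rule cp_cone_subset_if_cp_boundary_subset) (use \<open>p \<ge> 2\<close> in simp)
  obtain M :: "real^'n^'n" where "M \<in> cp_cone" "cp_rank M = enat p"
    using max_cp_rank_attained p by metis
  then have "enat p \<le> enat (p - 1)" using sub cp_rank_le_iff by (metis subsetD)
  then show False using \<open>p \<ge> 2\<close> by simp
qed

text \<open>If a ball around \<open>M\<close> lay in the cone, its translate by \<open>N\<close>
  would be such a ball around \<open>M + N\<close>.\<close>

lemma cp_boundary_summand:
  assumes "M + N \<in> cp_boundary" "M \<in> cp_cone" "N \<in> cp_cone"
  shows "M \<in> cp_boundary"
proof (rule ccontr)
  assume "M \<notin> cp_boundary"
  then obtain e where e: "e > 0" "\<And>X. X \<in> symmetric_matrices \<Longrightarrow> dist X M < e \<Longrightarrow> X \<in> cp_cone"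
    using assms(2) by (auto simp: cp_boundary_iff)
  have "X \<in> cp_cone" if "X \<in> symmetric_matrices" "dist X (M + N) < e" for X
  proof -
    have "N \<in> symmetric_matrices" using assms(3) cp_cone_symmetric by blast
    then have "X - N \<in> cp_cone"
      using that
      by (intro e subspace_diff[OF subspace_symmetric_matrices]) (simp_all add: dist_norm algebra_simps)
    then show ?thesis using convex_cone_add[OF convex_cone_cp_cone, of "X - N" N] assms(3) by simp
  qed
  then show False using e(1) assms(1) by (auto simp: cp_boundary_iff)
qed

theorem proposition4p1:
  fixes k :: nat
  assumes "CARD('n::finite) \<ge> 2"
    and "1 \<le> k"
    and "enat k \<le> max_cp_rank TYPE('n)"
  shows "\<exists>M :: real^'n^'n. M \<in> cp_boundary \<and> cp_rank M = enat k"
proof -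
  \<comment> \<open>The maximum is finite, being the cp-rank of a completely positive
    matrix.\<close>
  obtain L :: "real^'n^'n" where "L \<in> cp_cone" "cp_rank L = max_cp_rank TYPE('n)"
    using max_cp_rank_attained by blast
  then obtain p where p: "max_cp_rank TYPE('n) = enat p"
    using cp_rank_le_iff unfolding cp_cone_eq_UN by (metis UN_E enat_ile)
  obtain M :: "real^'n^'n" where M: "M \<in> cp_boundary" "cp_rank M = enat p"
    using exists_cp_boundary_max_cp_rank[OF assms(1) p] by blast
  have kp: "k \<le> p" using assms(3) p by simp
  \<comment> \<open>Cut a factorization with \<open>p\<close> columns after the first
    \<open>k\<close>.\<close>
  have "M \<in> cp_factorizable (k + (p - k))"
    using M(2) cp_rank_le_iff[of M p] kp by simp
  then obtain A B where A: "A \<in> cp_factorizable k" and B: "B \<in> cp_factorizable (p - k)" and "M = A + B"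
    by (rule cp_factorizable_split)
  then have "A \<in> cp_boundary"
    using M(1) cp_factorizable_subset_cp_cone by (intro cp_boundary_summand[of A B]) auto
  \<comment> \<open>Saving a column in \<open>A\<close> would save one in \<open>M\<close>, which
    needs all \<open>p\<close>.\<close>
  moreover have "\<not> cp_rank A \<le> enat (k - 1)"
  proof
    assume "cp_rank A \<le> enat (k - 1)"
    then have "A \<in> cp_factorizable (k - 1)" using cp_rank_le_iff by blast
    then have "M \<in> cp_factorizable (k - 1 + (p - k))"
      unfolding \<open>M = A + B\<close> using B by (rule cp_factorizable_add)
    then have "cp_rank M \<le> enat (k - 1 + (p - k))" using cp_rank_le_iff by blast
    then show False using M(2) kp assms(2) by simp
  qed
  moreover have "cp_rank A \<le> enat k" using A cp_rank_le_iff by blast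
  ultimately show ?thesis by (intro exI[of _ A]) (cases "cp_rank A", auto)
qed

end
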